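(* Let $\mathcal{C}$ be a pre-rigid monoidal category. If $\mathcal{C}$ has products of pre-duals (i.e. for every set-indexed family $(Y_j)_{j\in J}$ of objects of $\mathcal{C}$ the product $\prod_{j\in J}Y_j^*$ exists in $\mathcal{C}$), then $\mathsf{Fam}(\mathcal{C})$ is pre-rigid and the pre-dual of $\underline{Y}=(J,Y_j)$ is $\underline{Y}^*=\big(\{*\},\prod_{j\in J}Y_j^*\big)$. Conversely, if $\mathcal{C}$ has an initial object and $\mathsf{Fam}(\mathcal{C})$ is pre-rigid, then $\mathcal{C}$ has products of pre-duals.
   Context: A monoidal category $(\mathcal{C},\otimes,\mathbb{I})$ is (right) pre-rigid if for every object $X$ there are an object $X^*$ (a pre-dual of $X$) and a morphism $\mathrm{ev}_X:X^*\otimes X\to\mathbb{I}$ such that for every object $T$ the map $\mathrm{Hom}_{\mathcal{C}}(T,X^* )\to\mathrm{Hom}_{\mathcal{C}}(T\otimes X,\mathbb{I})$, $u\mapsto \mathrm{ev}_X\circ(u\otimes X)$, is bijective. Here $X$ also denotes the identity morphism of $X$. No braiding is assumed. The category $\mathsf{Fam}(\mathcal{C})$: an object is a pair $\underline{X}=(I,X_i)$ where $I$ is a set and $X_i$ is an object of $\mathcal{C}$ for each $i\in I$. A morphism $(I,X_i)\to(J,Y_j)$ is a pair $(f,\phi_i)$ where $f:I\to J$ is a map and $\phi_i:X_i\to Y_{f(i)}$ is a morphism of $\mathcal{C}$ for each $i\in I$. If $\mathcal{C}$ is monoidal, so is $\mathsf{Fam}(\mathcal{C})$, with $(I,X_i)\otimes(J,Y_j)=(I\times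 J,X_i\otimes Y_j)$, $(f,\phi_i)\otimes(f',\phi'_{i'})=(f\times f',\phi_i\otimes\phi'_{i'})$, and unit object $(\{*\},\mathbb{I})$. *)

theory Defs
  imports Main "HOL-Library.FuncSet"
begin

record ('o, 'm) category =
  Obj :: "'o set"
  Arr :: "'m set"
  Dom :: "'m \<Rightarrow> 'o"
  Cod :: "'m \<Rightarrow> 'o"
  Ident :: "'o \<Rightarrow> 'm"
  Comp :: "'m \<Rightarrow> 'm \<Rightarrow> 'm"  (infixl "\<cdot>\<index>" 70)

definition hom :: "('o, 'm, 'z) category_scheme \<Rightarrow> 'o \<Rightarrow> 'o \<Rightarrow> 'm set" where
  "hom C A B = {f \<in> Arr C. Dom C f = A \<and> Cod C f = B}"

locale category =
  fixes C :: "('o, 'm, 'z) category_scheme" (structure)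
  assumes Dom_in_Obj: "f \<in> Arr C \<Longrightarrow> Dom C f \<in> Obj C"
    and Cod_in_Obj: "f \<in> Arr C \<Longrightarrow> Cod C f \<in> Obj C"
    and Ident_in_hom: "A \<in> Obj C \<Longrightarrow> Ident C A \<in> hom C A A"
    and Comp_in_hom: "f \<in> hom C A B \<Longrightarrow> g \<in> hom C B D \<Longrightarrow> g \<cdot> f \<in> hom C A D"
    and Comp_Ident_left: "f \<in> hom C A B \<Longrightarrow> Ident C B \<cdot> f = f"
    and Comp_Ident_right: "f \<in> hom C A B \<Longrightarrow> f \<cdot> Ident C A = f"
    and Comp_assoc: "f \<in> hom C A B \<Longrightarrow> g \<in> hom C B D \<Longrightarrow> h \<in> hom C D E
      \<Longrightarrow> (h \<cdot> g) \<cdot> f = h \<cdot> (g \<cdot> f)"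

definition isos :: "('o, 'm, 'z) category_scheme \<Rightarrow> 'o \<Rightarrow> 'o \<Rightarrow> 'm set" where
  "isos C A B = {f \<in> hom C A B. \<exists>g \<in> hom C B A.
     Comp C g f = Ident C A \<and> Comp C f g = Ident C B}"

definition is_initial :: "('o, 'm, 'z) category_scheme \<Rightarrow> 'o \<Rightarrow> bool" where
  "is_initial C Z \<longleftrightarrow> Z \<in> Obj C \<and> (\<forall>A \<in> Obj C. \<exists>!f. f \<in> hom C Z A)"

definition is_product ::
  "('o, 'm, 'z) category_scheme \<Rightarrow> 'i set \<Rightarrow> ('i \<Rightarrow> 'o) \<Rightarrow> 'o \<Rightarrow> ('i \<Rightarrow> 'm) \<Rightarrow> bool" where
  "is_product C J A P \<pi> \<longleftrightarrow>
     P \<in> Obj C \<and> (\<forall>j \<in> J. A j \<in> Obj C) \<and> (\<forall>j \<in> J. \<pi> j \<in> hom C P (A j)) \<and>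
     (\<forall>T \<in> Obj C. \<forall>g. (\<forall>j \<in> J. g j \<in> hom C T (A j)) \<longrightarrow>
       (\<exists>!h. h \<in> hom C T P \<and> (\<forall>j \<in> J. Comp C (\<pi> j) h = g j)))"

record ('o, 'm) moncat = "('o, 'm) category" +
  Tensor :: "'o \<Rightarrow> 'o \<Rightarrow> 'o"  (infixl "\<otimes>\<index>" 75)
  Tensor_arr :: "'m \<Rightarrow> 'm \<Rightarrow> 'm"  (infixl "\<boxtimes>\<index>" 75)
  Unit :: 'o
  Assoc :: "'o \<Rightarrow> 'o \<Rightarrow> 'o \<Rightarrow> 'm"
  Lunit :: "'o \<Rightarrow> 'm"
  Runit :: "'o \<Rightarrow> 'm"

locale monoidal_category = category C
  for C :: "('o, 'm, 'z) moncat_scheme" (structure) +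
  assumes Tensor_in_Obj: "A \<in> Obj C \<Longrightarrow> B \<in> Obj C \<Longrightarrow> A \<otimes> B \<in> Obj C"
    and Tensor_in_hom: "f \<in> hom C A B \<Longrightarrow> f' \<in> hom C A' B' \<Longrightarrow>
      f \<boxtimes> f' \<in> hom C (A \<otimes> A') (B \<otimes> B')"
    and Tensor_Ident: "A \<in> Obj C \<Longrightarrow> B \<in> Obj C \<Longrightarrow>
      Ident C A \<boxtimes> Ident C B = Ident C (A \<otimes> B)"
    and Tensor_Comp: "f \<in> hom C A B \<Longrightarrow> g \<in> hom C B D \<Longrightarrow>
      f' \<in> hom C A' B' \<Longrightarrow> g' \<in> hom C B' D' \<Longrightarrow>
      (g \<cdot> f) \<boxtimes> (g' \<cdot> f') = (g \<boxtimes> g') \<cdot> (f \<boxtimes> f')"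
    and Unit_in_Obj: "Unit C \<in> Obj C"
    and Assoc_iso: "A \<in> Obj C \<Longrightarrow> B \<in> Obj C \<Longrightarrow> D \<in> Obj C \<Longrightarrow>
      Assoc C A B D \<in> isos C ((A \<otimes> B) \<otimes> D) (A \<otimes> (B \<otimes> D))"
    and Lunit_iso: "A \<in> Obj C \<Longrightarrow> Lunit C A \<in> isos C (Unit C \<otimes> A) A"
    and Runit_iso: "A \<in> Obj C \<Longrightarrow> Runit C A \<in> isos C (A \<otimes> Unit C) A"
    and Assoc_natural: "f \<in> hom C A A' \<Longrightarrow> g \<in> hom C B B' \<Longrightarrow> h \<in> hom C D D' \<Longrightarrow>
      Assoc C A' B' D' \<cdot> ((f \<boxtimes> g) \<boxtimes> h) = (f \<boxtimes> (g \<boxtimes> h)) \<cdot> Assoc C A B D"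
    and Lunit_natural: "f \<in> hom C A B \<Longrightarrow>
      Lunit C B \<cdot> (Ident C (Unit C) \<boxtimes> f) = f \<cdot> Lunit C A"
    and Runit_natural: "f \<in> hom C A B \<Longrightarrow>
      Runit C B \<cdot> (f \<boxtimes> Ident C (Unit C)) = f \<cdot> Runit C A"
    and pentagon: "A \<in> Obj C \<Longrightarrow> B \<in> Obj C \<Longrightarrow> D \<in> Obj C \<Longrightarrow> E \<in> Obj C \<Longrightarrow>
      (Ident C A \<boxtimes> Assoc C B D E) \<cdot> Assoc C A (B \<otimes> D) E \<cdot> (Assoc C A B D \<boxtimes> Ident C E) =
      Assoc C A B (D \<otimes> E) \<cdot> Assoc C (A \<otimes> B) D E"
    and triangle: "A \<in> Obj C \<Longrightarrow> B \<in> Obj C \<Longrightarrow>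
      (Ident C A \<boxtimes> Lunit C B) \<cdot> Assoc C A (Unit C) B = Runit C A \<boxtimes> Ident C B"

definition is_pre_dual ::
  "('o, 'm, 'z) moncat_scheme \<Rightarrow> 'o \<Rightarrow> 'o \<Rightarrow> 'm \<Rightarrow> bool" where
  "is_pre_dual C X D ev \<longleftrightarrow>
     X \<in> Obj C \<and> D \<in> Obj C \<and> ev \<in> hom C (Tensor C D X) (Unit C) \<and>
     (\<forall>T \<in> Obj C. bij_betw (\<lambda>u. Comp C ev (Tensor_arr C u (Ident C X)))
        (hom C T D) (hom C (Tensor C T X) (Unit C)))"

definition pre_rigid :: "('o, 'm, 'z) moncat_scheme \<Rightarrow> bool" where
  "pre_rigid C \<longleftrightarrow> monoidal_category C \<and> (\<forall>X \<in> Obj C. \<exists>D ev. is_pre_dual C X D ev)"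

text \<open>
  HOL has no type of all sets, so the index sets range over a universe: a collection of
  subsets of an arbitrary type, closed under binary products formed with an injective pairing
  and containing a singleton. These are the only closure properties that
  the monoidal structure of Fam requires. Taking for the index type the elements of a model of
  set theory, for the pairing the Kuratowski pairing, and for \<open>Small\<close> the sets belonging to a
  Grothendieck universe gives the usual Fam; taking for \<open>Small\<close> all subsets of an infinite
  type gives families of bounded cardinality.
\<close>

record 'i universe =
  Small :: "'i set set"
  pairing :: "'i \<times> 'i \<Rightarrow> 'i"
  Point :: 'i

definition index_prod :: "'i universe \<Rightarrow> 'i set \<Rightarrow> 'i set \<Rightarrow> 'i set" where
  "index_prod U I J = pairing U ` (I \<times> J)"

definition index_universe :: "'i universe \<Rightarrow> bool" where
  "index_universe U \<longleftrightarrow> inj (pairing U) \<and> {Point U} \<in> Small U \<and>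
     (\<forall>I \<in> Small U. \<forall>J \<in> Small U. index_prod U I J \<in> Small U)"

abbreviation unpair :: "'i universe \<Rightarrow> 'i \<Rightarrow> 'i \<times> 'i" where
  "unpair U \<equiv> inv (pairing U)"

abbreviation proj1 :: "'i universe \<Rightarrow> 'i \<Rightarrow> 'i" where
  "proj1 U k \<equiv> fst (unpair U k)"

abbreviation proj2 :: "'i universe \<Rightarrow> 'i \<Rightarrow> 'i" where
  "proj2 U k \<equiv> snd (unpair U k)"

text \<open>
  Members and components are extensional (fixed to \<open>undefined\<close> off the index set), so that
  equality of objects and of morphisms in HOL is the intended one.
\<close>

datatype ('i, 'o) family = Family (index: "'i set") (member: "'i \<Rightarrow> 'o")

datatype ('i, 'o, 'm) family_arr =
  Family_arr (source: "('i, 'o) family") (target: "('i, 'o) family")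
    (index_map: "'i \<Rightarrow> 'i") (component: "'i \<Rightarrow> 'm")

definition families :: "'i universe \<Rightarrow> ('o, 'm, 'z) category_scheme \<Rightarrow> ('i, 'o) family set" where
  "families U C = {Family I X | I X. I \<in> Small U \<and> X \<in> I \<rightarrow>\<^sub>E Obj C}"

definition family_arrs ::
  "'i universe \<Rightarrow> ('o, 'm, 'z) category_scheme \<Rightarrow> ('i, 'o, 'm) family_arr set" where
  "family_arrs U C = {Family_arr X Y f \<phi> | X Y f \<phi>.
     X \<in> families U C \<and> Y \<in> families U C \<and> f \<in> index X \<rightarrow>\<^sub>E index Y \<and>
     \<phi> \<in> (\<Pi>\<^sub>E i \<in> index X. hom C (member X i) (member Y (f i)))}"

definition family_tensor ::
  "'i universe \<Rightarrow> ('o, 'm, 'z) moncat_scheme \<Rightarrow>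
   ('i, 'o) family \<Rightarrow> ('i, 'o) family \<Rightarrow> ('i, 'o) family" where
  "family_tensor U C X Y = Family (index_prod U (index X) (index Y))
     (\<lambda>k \<in> index_prod U (index X) (index Y).
        Tensor C (member X (proj1 U k)) (member Y (proj2 U k)))"

definition family_unit :: "'i universe \<Rightarrow> ('o, 'm, 'z) moncat_scheme \<Rightarrow> ('i, 'o) family" where
  "family_unit U C = Family {Point U} (\<lambda>k \<in> {Point U}. Unit C)"

definition Fam ::
  "'i universe \<Rightarrow> ('o, 'm, 'z) moncat_scheme \<Rightarrow> (('i, 'o) family, ('i, 'o, 'm) family_arr) moncat"
where
  "Fam U C = \<lparr>
     Obj = families U C,
     Arr = family_arrs U C,
     Dom = source,
     Cod = target,
     Ident = (\<lambda>X. Family_arr X X (\<lambda>i \<in> index X. i) (\<lambda>i \<in> index X. Ident C (member X i))),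
     Comp = (\<lambda>G F. Family_arr (source F) (target G)
       (\<lambda>i \<in> index (source F). index_map G (index_map F i))
       (\<lambda>i \<in> index (source F). Comp C (component G (index_map F i)) (component F i))),
     Tensor = family_tensor U C,
     Tensor_arr = (\<lambda>F G. Family_arr
       (family_tensor U C (source F) (source G)) (family_tensor U C (target F) (target G))
       (\<lambda>k \<in> index_prod U (index (source F)) (index (source G)).
          pairing U (index_map F (proj1 U k), index_map G (proj2 U k)))
       (\<lambda>k \<in> index_prod U (index (source F)) (index (source G)).
          Tensor_arr C (component F (proj1 U k)) (component G (proj2 U k)))),
     Unit = family_unit U C,
     Assoc = (\<lambda>X Y Z. Family_arr
       (family_tensor U C (family_tensor U C X Y) Z) (family_tensor U C X (family_tensor U C Y Z))
       (\<lambda>k \<in> index_prod U (index_prod U (index X) (index Y)) (index Z).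
          pairing U (proj1 U (proj1 U k), pairing U (proj2 U (proj1 U k), proj2 U k)))
       (\<lambda>k \<in> index_prod U (index_prod U (index X) (index Y)) (index Z).
          Assoc C (member X (proj1 U (proj1 U k))) (member Y (proj2 U (proj1 U k)))
            (member Z (proj2 U k)))),
     Lunit = (\<lambda>X. Family_arr (family_tensor U C (family_unit U C) X) X
       (\<lambda>k \<in> index_prod U {Point U} (index X). proj2 U k)
       (\<lambda>k \<in> index_prod U {Point U} (index X). Lunit C (member X (proj2 U k)))),
     Runit = (\<lambda>X. Family_arr (family_tensor U C X (family_unit U C)) X
       (\<lambda>k \<in> index_prod U (index X) {Point U}. proj1 U k)
       (\<lambda>k \<in> index_prod U (index X) {Point U}. Runit C (member X (proj1 U k))))\<rparr>"

text \<open>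
  Here \<open>dual\<close> is a choice of pre-dual for every object. Pre-duals are unique up to isomorphism,
  so the existence of the products does not depend on the choice.
\<close>

definition has_products_of_pre_duals ::
  "'i universe \<Rightarrow> ('o, 'm, 'z) category_scheme \<Rightarrow> ('o \<Rightarrow> 'o) \<Rightarrow> bool" where
  "has_products_of_pre_duals U C dual \<longleftrightarrow>
     (\<forall>J \<in> Small U. \<forall>Y. (\<forall>j \<in> J. Y j \<in> Obj C) \<longrightarrow>
        (\<exists>P \<pi>. is_product C J (\<lambda>j. dual (Y j)) P \<pi>))"

end

theory Submission
  imports Defs
begin

text \<open>
  Call \<open>P\<close> with morphisms \<open>\<epsilon>\<^sub>j : P \<otimes> Y\<^sub>j \<rightarrow> I\<close> a joint pre-dual of the family \<open>Y\<close> if it represents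
  \<open>T \<mapsto> \<Prod>\<^sub>j Hom (T \<otimes> Y\<^sub>j, I)\<close>. Since \<open>Hom (T \<otimes> Y\<^sub>j, I) \<cong> Hom (T, Y\<^sub>j\<^sup>*)\<close> naturally in \<open>T\<close>, joint
  pre-duals are the same as products of the \<open>Y\<^sub>j\<^sup>*\<close>. As the index set of the unit of \<open>Fam\<close> is a
  singleton, morphisms from \<open>(I, T\<^sub>i) \<otimes> Y\<close> to the unit are the elements of
  \<open>\<Prod>\<^sub>i\<^sub>,\<^sub>j Hom (T\<^sub>i \<otimes> Y\<^sub>j, I)\<close>, so a joint pre-dual, as a singleton family, is a pre-dual of \<open>Y\<close>.
  Conversely, let \<open>(K, D\<^sub>k)\<close> be a pre-dual of \<open>Y\<close> in \<open>Fam\<close>. Testing it on the singleton family of an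
  initial object \<open>Z\<close>, where \<open>Hom (Z, D\<^sub>k)\<close> and \<open>Hom (Z, Y\<^sub>j\<^sup>*)\<close> are singletons, shows that \<open>K\<close> has
  exactly one element \<open>k\<close>; testing it on arbitrary singleton families shows that \<open>D\<^sub>k\<close> is a joint
  pre-dual.
\<close>


section \<open>Structure maps and hom sets of Fam, unfolded\<close>

lemma Fam_simps [simp]:
  "Obj (Fam U C) = families U C"
  "Arr (Fam U C) = family_arrs U C"
  "Dom (Fam U C) = source"
  "Cod (Fam U C) = target"
  "Tensor (Fam U C) = family_tensor U C"
  "Unit (Fam U C) = family_unit U C"
  by (simp_all add: Fam_def)

lemma Ident_Fam_simps [simp]:
  "source (Ident (Fam U C) X) = X"
  "target (Ident (Fam U C) X) = X"
  "index_map (Ident (Fam U C) X) = (\<lambda>i \<in> index X. i)"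
  "component (Ident (Fam U C) X) = (\<lambda>i \<in> index X. Ident C (member X i))"
  by (simp_all add: Fam_def)

lemma Comp_Fam_simps [simp]:
  "source (Comp (Fam U C) G F) = source F"
  "target (Comp (Fam U C) G F) = target G"
  "index_map (Comp (Fam U C) G F) = (\<lambda>i \<in> index (source F). index_map G (index_map F i))"
  "component (Comp (Fam U C) G F) =
    (\<lambda>i \<in> index (source F). Comp C (component G (index_map F i)) (component F i))"
  by (simp_all add: Fam_def)

lemma Tensor_arr_Fam_simps [simp]:
  "source (Tensor_arr (Fam U C) F G) = family_tensor U C (source F) (source G)"
  "target (Tensor_arr (Fam U C) F G) = family_tensor U C (target F) (target G)"
  "index_map (Tensor_arr (Fam U C) F G) =
    (\<lambda>k \<in> index_prod U (index (source F)) (index (source G)).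
      pairing U (index_map F (proj1 U k), index_map G (proj2 U k)))"
  "component (Tensor_arr (Fam U C) F G) =
    (\<lambda>k \<in> index_prod U (index (source F)) (index (source G)).
      Tensor_arr C (component F (proj1 U k)) (component G (proj2 U k)))"
  by (simp_all add: Fam_def)

lemma Assoc_Fam_simps [simp]:
  "source (Assoc (Fam U C) X Y Z) = family_tensor U C (family_tensor U C X Y) Z"
  "target (Assoc (Fam U C) X Y Z) = family_tensor U C X (family_tensor U C Y Z)"
  "index_map (Assoc (Fam U C) X Y Z) =
    (\<lambda>k \<in> index_prod U (index_prod U (index X) (index Y)) (index Z).
      pairing U (proj1 U (proj1 U k), pairing U (proj2 U (proj1 U k), proj2 U k)))"
  "component (Assoc (Fam U C) X Y Z) =
    (\<lambda>k \<in> index_prod U (index_prod U (index X) (index Y)) (index Z).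
      Assoc C (member X (proj1 U (proj1 U k))) (member Y (proj2 U (proj1 U k)))
        (member Z (proj2 U k)))"
  by (simp_all add: Fam_def)

lemma Lunit_Fam_simps [simp]:
  "source (Lunit (Fam U C) X) = family_tensor U C (family_unit U C) X"
  "target (Lunit (Fam U C) X) = X"
  "index_map (Lunit (Fam U C) X) = (\<lambda>k \<in> index_prod U {Point U} (index X). proj2 U k)"
  "component (Lunit (Fam U C) X) =
    (\<lambda>k \<in> index_prod U {Point U} (index X). Lunit C (member X (proj2 U k)))"
  by (simp_all add: Fam_def)

lemma Runit_Fam_simps [simp]:
  "source (Runit (Fam U C) X) = family_tensor U C X (family_unit U C)"
  "target (Runit (Fam U C) X) = X"
  "index_map (Runit (Fam U C) X) = (\<lambda>k \<in> index_prod U (index X) {Point U}. proj1 U k)"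
  "component (Runit (Fam U C) X) =
    (\<lambda>k \<in> index_prod U (index X) {Point U}. Runit C (member X (proj1 U k)))"
  by (simp_all add: Fam_def)

lemma index_family_tensor [simp]:
  "index (family_tensor U C X Y) = index_prod U (index X) (index Y)"
  by (simp add: family_tensor_def)

lemma family_unit_simps [simp]:
  "index (family_unit U C) = {Point U}"
  "member (family_unit U C) (Point U) = Unit C"
  by (simp_all add: family_unit_def)

lemma in_families_iff:
  "X \<in> families U C \<longleftrightarrow> index X \<in> Small U \<and> member X \<in> index X \<rightarrow>\<^sub>E Obj C"
  by (cases X) (auto simp: families_def)

lemma hom_Fam_iff:
  "F \<in> hom (Fam U C) X Y \<longleftrightarrow> source F = X \<and> target F = Y \<and>
    X \<in> families U C \<and> Y \<in> families U C \<and> index_map F \<in> index X \<rightarrow>\<^sub>E index Y \<and>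
    component F \<in> (\<Pi>\<^sub>E i \<in> index X. hom C (member X i) (member Y (index_map F i)))"
  by (cases F) (auto simp: hom_def family_arrs_def)

lemma hom_FamD:
  assumes "F \<in> hom (Fam U C) X Y"
  shows "source F = X" and "target F = Y"
    and "X \<in> families U C" and "Y \<in> families U C"
    and "i \<in> index X \<Longrightarrow> index_map F i \<in> index Y"
    and "i \<in> index X \<Longrightarrow> component F i \<in> hom C (member X i) (member Y (index_map F i))"
  using assms by (auto simp: hom_Fam_iff)

lemma hom_FamI:
  assumes "source F = X" and "target F = Y"
    and "X \<in> families U C" and "Y \<in> families U C"
    and "index_map F \<in> extensional (index X)" and "component F \<in> extensional (index X)"
    and "\<And>i. i \<in> index X \<Longrightarrow> index_map F i \<in> index Y"
    and "\<And>i. i \<in> index X \<Longrightarrow> component F i \<in> hom C (member X i) (member Y (index_map F i))"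
  shows "F \<in> hom (Fam U C) X Y"
  using assms by (auto simp: hom_Fam_iff PiE_def)

text \<open>Index maps and components are extensional, so agreement on the index set is equality.
  Diagrams in Fam thereby reduce to equations between indices and one diagram in \<open>C\<close>
  for each index.\<close>

lemma hom_Fam_eqI:
  assumes F: "F \<in> hom (Fam U C) X Y" and G: "G \<in> hom (Fam U C) X Y"
    and idx: "\<And>i. i \<in> index X \<Longrightarrow> index_map F i = index_map G i"
    and cmp: "\<And>i. i \<in> index X \<Longrightarrow> component F i = component G i"
  shows "F = G"
proof -
  have "index_map F = index_map G"
    using F G idx by (intro extensionalityI[of _ "index X"]) (auto simp: hom_Fam_iff PiE_def)
  moreover have "component F = component G"
    using F G cmp by (intro extensionalityI[of _ "index X"]) (auto simp: hom_Fam_iff PiE_def)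
  ultimately show ?thesis
    using F G by (intro family_arr.expand) (simp add: hom_Fam_iff)
qed

section \<open>Fam as a category, and its isomorphisms\<close>

context monoidal_category
begin

lemma member_in_Obj: "X \<in> families U C \<Longrightarrow> i \<in> index X \<Longrightarrow> member X i \<in> Obj C"
  by (auto simp: in_families_iff)

lemma Fam_Ident_in_hom:
  "X \<in> families U C \<Longrightarrow> Ident (Fam U C) X \<in> hom (Fam U C) X X"
  by (rule hom_FamI) (auto simp: Ident_in_hom member_in_Obj)

lemma Fam_Comp_in_hom:
  assumes F: "F \<in> hom (Fam U C) X Y" and G: "G \<in> hom (Fam U C) Y Z"
  shows "Comp (Fam U C) G F \<in> hom (Fam U C) X Z"
  by (rule hom_FamI)
    (auto simp: hom_FamD[OF F] hom_FamD[OF G] intro!: Comp_in_hom hom_FamD[OF F] hom_FamD[OF G])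

lemma category_Fam: "category (Fam U C)"
proof
  fix F G H X Y Z W
  show "Dom (Fam U C) F \<in> Obj (Fam U C)" if "F \<in> Arr (Fam U C)"
    using that by (auto simp: family_arrs_def)
  show "Cod (Fam U C) F \<in> Obj (Fam U C)" if "F \<in> Arr (Fam U C)"
    using that by (auto simp: family_arrs_def)
  show "Ident (Fam U C) X \<in> hom (Fam U C) X X" if "X \<in> Obj (Fam U C)"
    using that by (simp add: Fam_Ident_in_hom)
  assume F: "F \<in> hom (Fam U C) X Y"
  note FD = hom_FamD[OF F]
  show "Comp (Fam U C) (Ident (Fam U C) Y) F = F"
    by (rule hom_Fam_eqI[OF Fam_Comp_in_hom[OF F Fam_Ident_in_hom] F])
      (use FD in \<open>auto intro!: Comp_Ident_left\<close>)
  show "Comp (Fam U C) F (Ident (Fam U C) X) = F"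
    by (rule hom_Fam_eqI[OF Fam_Comp_in_hom[OF Fam_Ident_in_hom F] F])
      (use FD in \<open>auto intro!: Comp_Ident_right\<close>)
  assume G: "G \<in> hom (Fam U C) Y Z"
  note GD = hom_FamD[OF G]
  show "Comp (Fam U C) G F \<in> hom (Fam U C) X Z"
    using F G by (rule Fam_Comp_in_hom)
  assume H: "H \<in> hom (Fam U C) Z W"
  note HD = hom_FamD[OF H]
  show "Comp (Fam U C) (Comp (Fam U C) H G) F = Comp (Fam U C) H (Comp (Fam U C) G F)"
    by (rule hom_Fam_eqI[OF Fam_Comp_in_hom[OF F Fam_Comp_in_hom[OF G H]]
          Fam_Comp_in_hom[OF Fam_Comp_in_hom[OF F G] H]])
      (auto simp: FD GD HD intro!: Comp_assoc FD GD HD)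
qed

text \<open>The inverse runs along the inverse bijection of index sets: its component at
  \<open>j\<close> is an inverse in \<open>C\<close> of the component of \<open>F\<close> at the
  preimage of \<open>j\<close>.\<close>

lemma iso_FamI:
  assumes F: "F \<in> hom (Fam U C) X Y"
    and bij: "bij_betw (index_map F) (index X) (index Y)"
    and iso: "\<And>i. i \<in> index X \<Longrightarrow>
      component F i \<in> isos C (member X i) (member Y (index_map F i))"
  shows "F \<in> isos (Fam U C) X Y"
proof -
  have "\<forall>i \<in> index X. \<exists>g. g \<in> hom C (member Y (index_map F i)) (member X i) \<and>
      g \<cdot> component F i = Ident C (member X i) \<and>
      component F i \<cdot> g = Ident C (member Y (index_map F i))"
    using iso unfolding isos_def by blast
  then obtain inv_cmp where inv_cmp: "\<And>i. i \<in> index X \<Longrightarrow>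
      inv_cmp i \<in> hom C (member Y (index_map F i)) (member X i) \<and>
      inv_cmp i \<cdot> component F i = Ident C (member X i) \<and>
      component F i \<cdot> inv_cmp i = Ident C (member Y (index_map F i))"
    by metis
  define section_map where "section_map = inv_into (index X) (index_map F)"
  have section_map: "section_map j \<in> index X" "index_map F (section_map j) = j"
    if "j \<in> index Y" for j
    using bij_betw_apply[OF bij_betw_inv_into[OF bij] that] bij_betw_inv_into_right[OF bij that]
    by (simp_all add: section_map_def)
  have section_map_left: "section_map (index_map F i) = i" if "i \<in> index X" for i
    using bij that unfolding section_map_def by (rule bij_betw_inv_into_left)
  define G where "G = Family_arr Y X (\<lambda>j \<in> index Y. section_map j) (\<lambda>j \<in> index Y. inv_cmp (section_map j))"
  note FD = hom_FamD[OF F]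
  have G: "G \<in> hom (Fam U C) Y X"
  proof (rule hom_FamI)
    fix j assume "j \<in> index Y"
    then show "component G j \<in> hom C (member Y j) (member X (index_map G j))"
      using inv_cmp[of "section_map j"] section_map[of j] by (simp add: G_def)
  qed (use FD section_map in \<open>auto simp: G_def\<close>)
  have "Comp (Fam U C) G F = Ident (Fam U C) X"
    by (rule hom_Fam_eqI[OF Fam_Comp_in_hom[OF F G] Fam_Ident_in_hom])
      (use FD section_map_left inv_cmp in \<open>auto simp: G_def\<close>)
  moreover have "Comp (Fam U C) F G = Ident (Fam U C) Y"
  proof (rule hom_Fam_eqI[OF Fam_Comp_in_hom[OF G F] Fam_Ident_in_hom])
    fix j assume "j \<in> index Y"
    then show "component (Comp (Fam U C) F G) j = component (Ident (Fam U C) Y) j"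
      using inv_cmp[of "section_map j"] section_map[of j] by (simp add: G_def)
  qed (use FD section_map in \<open>auto simp: G_def\<close>)
  ultimately show ?thesis
    using F G unfolding isos_def by blast
qed

end

section \<open>The monoidal structure of Fam\<close>

lemma isos_in_hom: "f \<in> isos C A B \<Longrightarrow> f \<in> hom C A B"
  by (simp add: isos_def)

locale monoidal_category_with_universe = monoidal_category C
  for C :: "('o, 'm, 'z) moncat_scheme" (structure) +
  fixes U :: "'i universe"
  assumes universe: "index_universe U"
begin

lemma unpair_pairing [simp]: "unpair U (pairing U p) = p"
  using universe by (simp add: index_universe_def)

lemma pairing_eq_iff [simp]: "pairing U p = pairing U q \<longleftrightarrow> p = q"
  using universe by (auto simp: index_universe_def dest: injD)

lemma pairing_in_index_prod [simp]:
  "pairing U (i, j) \<in> index_prod U I J \<longleftrightarrow> i \<in> I \<and> j \<in> J"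
  by (auto simp: index_prod_def)

lemma index_prodE:
  assumes "k \<in> index_prod U I J"
  obtains i j where "k = pairing U (i, j)" and "i \<in> I" and "j \<in> J"
  using assms by (auto simp: index_prod_def)

lemma member_family_tensor [simp]:
  "i \<in> index X \<Longrightarrow> j \<in> index Y \<Longrightarrow>
    member (family_tensor U C X Y) (pairing U (i, j)) = member X i \<otimes> member Y j"
  by (simp add: family_tensor_def)

lemma family_tensor_in_families:
  assumes "X \<in> families U C" and "Y \<in> families U C"
  shows "family_tensor U C X Y \<in> families U C"
  using assms universe unfolding in_families_iff index_universe_def family_tensor_def
  by (fastforce intro!: Tensor_in_Obj elim!: index_prodE)

lemma family_unit_in_families: "family_unit U C \<in> families U C"
  using universe Unit_in_Obj by (auto simp: in_families_iff index_universe_def family_unit_def)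

lemma Fam_Tensor_arr_in_hom:
  assumes F: "F \<in> hom (Fam U C) X Y" and G: "G \<in> hom (Fam U C) X' Y'"
  shows "Tensor_arr (Fam U C) F G \<in>
    hom (Fam U C) (family_tensor U C X X') (family_tensor U C Y Y')"
  by (rule hom_FamI)
    (use hom_FamD[OF F] hom_FamD[OF G] in
      \<open>auto intro!: family_tensor_in_families Tensor_in_hom elim!: index_prodE\<close>)

text \<open>Indices are rebracketed and components are associators of \<open>C\<close>; the witness
  for the bijection rebrackets in the opposite direction.\<close>

lemma Fam_Assoc_iso:
  assumes "X \<in> families U C" and "Y \<in> families U C" and "Z \<in> families U C"
  shows "Assoc (Fam U C) X Y Z \<in> isos (Fam U C)
    (family_tensor U C (family_tensor U C X Y) Z) (family_tensor U C X (family_tensor U C Y Z))"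
proof (rule iso_FamI)
  show "bij_betw (index_map (Assoc (Fam U C) X Y Z))
      (index (family_tensor U C (family_tensor U C X Y) Z))
      (index (family_tensor U C X (family_tensor U C Y Z)))"
    by (rule bij_betw_byWitness[where f' = "\<lambda>k.
          pairing U (pairing U (proj1 U k, proj1 U (proj2 U k)), proj2 U (proj2 U k))"])
      (auto elim!: index_prodE)
qed (use assms in \<open>auto intro!: hom_FamI family_tensor_in_families Assoc_iso Assoc_iso[THEN isos_in_hom]
    member_in_Obj elim!: index_prodE\<close>)

lemma Fam_Lunit_iso:
  assumes "X \<in> families U C"
  shows "Lunit (Fam U C) X \<in> isos (Fam U C) (family_tensor U C (family_unit U C) X) X"
proof (rule iso_FamI)
  show "bij_betw (index_map (Lunit (Fam U C) X))
      (index (family_tensor U C (family_unit U C) X)) (index X)"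
    by (rule bij_betw_byWitness[where f' = "\<lambda>i. pairing U (Point U, i)"])
      (auto elim!: index_prodE)
qed (use assms in \<open>auto intro!: hom_FamI family_tensor_in_families family_unit_in_families
    Lunit_iso Lunit_iso[THEN isos_in_hom] member_in_Obj elim!: index_prodE\<close>)

lemma Fam_Runit_iso:
  assumes "X \<in> families U C"
  shows "Runit (Fam U C) X \<in> isos (Fam U C) (family_tensor U C X (family_unit U C)) X"
proof (rule iso_FamI)
  show "bij_betw (index_map (Runit (Fam U C) X))
      (index (family_tensor U C X (family_unit U C))) (index X)"
    by (rule bij_betw_byWitness[where f' = "\<lambda>i. pairing U (i, Point U)"])
      (auto elim!: index_prodE)
qed (use assms in \<open>auto intro!: hom_FamI family_tensor_in_families family_unit_in_families
    Runit_iso Runit_iso[THEN isos_in_hom] member_in_Obj elim!: index_prodE\<close>)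

text \<open>Typing rules for the morphisms in the coherence diagrams. Applied repeatedly, they
  discharge the two hom premises of \<open>hom_Fam_eqI\<close> and thereby determine the source and
  target families.\<close>

lemmas Fam_in_hom = Fam_Comp_in_hom Fam_Ident_in_hom Fam_Tensor_arr_in_hom
  Fam_Assoc_iso[THEN isos_in_hom] Fam_Lunit_iso[THEN isos_in_hom] Fam_Runit_iso[THEN isos_in_hom]
  family_tensor_in_families family_unit_in_families

text \<open>Each equational axiom is compared index by index. Once pairs are decoded the index maps
  agree, and equality of the components is the same axiom of \<open>C\<close> at the members
  concerned.\<close>

lemma monoidal_category_Fam: "monoidal_category (Fam U C)"
proof -
  interpret Fam: category "Fam U C" by (rule category_Fam)
  show ?thesis
  proof (unfold_locales, unfold Fam_simps)
    fix F F' G G' H X Y Z X' Y' Z' W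
    show "family_tensor U C X Y \<in> families U C" if "X \<in> families U C" "Y \<in> families U C"
      using that by (rule family_tensor_in_families)
    show "family_unit U C \<in> families U C"
      by (rule family_unit_in_families)
    show "Tensor_arr (Fam U C) F G \<in>
        hom (Fam U C) (family_tensor U C X X') (family_tensor U C Y Y')"
      if "F \<in> hom (Fam U C) X Y" "G \<in> hom (Fam U C) X' Y'"
      using that by (rule Fam_Tensor_arr_in_hom)
    show "Tensor_arr (Fam U C) (Ident (Fam U C) X) (Ident (Fam U C) Y) =
        Ident (Fam U C) (family_tensor U C X Y)"
      if "X \<in> families U C" "Y \<in> families U C"
      by (rule hom_Fam_eqI, (rule Fam_in_hom that)+)
        (use that in \<open>auto elim!: index_prodE simp: Tensor_Ident member_in_Obj\<close>)
    show "Assoc (Fam U C) X Y Z \<in> isos (Fam U C)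
        (family_tensor U C (family_tensor U C X Y) Z) (family_tensor U C X (family_tensor U C Y Z))"
      if "X \<in> families U C" "Y \<in> families U C" "Z \<in> families U C"
      using that by (rule Fam_Assoc_iso)
    show "Lunit (Fam U C) X \<in> isos (Fam U C) (family_tensor U C (family_unit U C) X) X"
      if "X \<in> families U C"
      using that by (rule Fam_Lunit_iso)
    show "Runit (Fam U C) X \<in> isos (Fam U C) (family_tensor U C X (family_unit U C)) X"
      if "X \<in> families U C"
      using that by (rule Fam_Runit_iso)
    show "Comp (Fam U C) (Comp (Fam U C)
          (Tensor_arr (Fam U C) (Ident (Fam U C) X) (Assoc (Fam U C) Y Z W))
          (Assoc (Fam U C) X (family_tensor U C Y Z) W))
          (Tensor_arr (Fam U C) (Assoc (Fam U C) X Y Z) (Ident (Fam U C) W)) =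
        Comp (Fam U C) (Assoc (Fam U C) X Y (family_tensor U C Z W))
          (Assoc (Fam U C) (family_tensor U C X Y) Z W)"
      if "X \<in> families U C" "Y \<in> families U C" "Z \<in> families U C" "W \<in> families U C"
      by (rule hom_Fam_eqI, (rule Fam_in_hom that)+)
        (use that in \<open>auto elim!: index_prodE simp: pentagon member_in_Obj\<close>)
    show "Comp (Fam U C) (Tensor_arr (Fam U C) (Ident (Fam U C) X) (Lunit (Fam U C) Y))
          (Assoc (Fam U C) X (family_unit U C) Y) =
        Tensor_arr (Fam U C) (Runit (Fam U C) X) (Ident (Fam U C) Y)"
      if "X \<in> families U C" "Y \<in> families U C"
      by (rule hom_Fam_eqI, (rule Fam_in_hom that)+)
        (use that in \<open>auto elim!: index_prodE simp: triangle member_in_Obj\<close>)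
    assume F: "F \<in> hom (Fam U C) X Y"
    note FD = hom_FamD[OF F]
    show "Comp (Fam U C) (Lunit (Fam U C) Y)
          (Tensor_arr (Fam U C) (Ident (Fam U C) (family_unit U C)) F) =
        Comp (Fam U C) F (Lunit (Fam U C) X)"
      by (rule hom_Fam_eqI, (rule Fam_in_hom F FD)+)
        (use FD in \<open>auto elim!: index_prodE intro!: Lunit_natural\<close>)
    show "Comp (Fam U C) (Runit (Fam U C) Y)
          (Tensor_arr (Fam U C) F (Ident (Fam U C) (family_unit U C))) =
        Comp (Fam U C) F (Runit (Fam U C) X)"
      by (rule hom_Fam_eqI, (rule Fam_in_hom F FD)+)
        (use FD in \<open>auto elim!: index_prodE intro!: Runit_natural\<close>)
    \<comment> \<open>Bifunctoriality and naturality of the associator stand in separate blocks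
      because they type \<open>G\<close> differently: composable with \<open>F\<close> in the first,
      another tensor factor in the second.\<close>
    {
      assume G: "G \<in> hom (Fam U C) Y Z" and F': "F' \<in> hom (Fam U C) X' Y'"
        and G': "G' \<in> hom (Fam U C) Y' Z'"
      note D = FD hom_FamD[OF G] hom_FamD[OF F'] hom_FamD[OF G']
      show "Tensor_arr (Fam U C) (Comp (Fam U C) G F) (Comp (Fam U C) G' F') =
          Comp (Fam U C) (Tensor_arr (Fam U C) G G') (Tensor_arr (Fam U C) F F')"
        by (rule hom_Fam_eqI, (rule Fam_in_hom F G F' G')+)
          (auto simp: D elim!: index_prodE intro!: Tensor_Comp D)
    next
      assume G: "G \<in> hom (Fam U C) X' Y'" and H: "H \<in> hom (Fam U C) Z Z'"
      note D = FD hom_FamD[OF G] hom_FamD[OF H]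
      show "Comp (Fam U C) (Assoc (Fam U C) Y Y' Z')
            (Tensor_arr (Fam U C) (Tensor_arr (Fam U C) F G) H) =
          Comp (Fam U C) (Tensor_arr (Fam U C) F (Tensor_arr (Fam U C) G H))
            (Assoc (Fam U C) X X' Z)"
        by (rule hom_Fam_eqI, (rule Fam_in_hom F G H D)+)
          (auto simp: D elim!: index_prodE intro!: Assoc_natural D)
    }
  qed
qed

end


section \<open>Joint pre-duals and products in a monoidal category\<close>

lemma bij_betw_iff_ex1:
  assumes "f \<in> A \<rightarrow> B"
  shows "bij_betw f A B \<longleftrightarrow> (\<forall>b \<in> B. \<exists>!a. a \<in> A \<and> f a = b)"
proof
  assume "bij_betw f A B"
  then show "\<forall>b \<in> B. \<exists>!a. a \<in> A \<and> f a = b"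
    unfolding bij_betw_def by (metis imageE inj_onD)
next
  assume ex1: "\<forall>b \<in> B. \<exists>!a. a \<in> A \<and> f a = b"
  show "bij_betw f A B"
  proof (rule bij_betw_imageI)
    show "inj_on f A"
      using assms ex1 by (intro inj_onI) (metis funcset_mem)
    show "f ` A = B"
      using assms ex1 by blast
  qed
qed

text \<open>The format copies \<open>is_product\<close>, with \<open>\<pi> j \<cdot> h\<close>
  replaced by \<open>\<epsilon> j \<cdot> (h \<boxtimes> Ident C (Y j))\<close>, so that the two
  notions are exchanged by rewriting the equations that characterise \<open>h\<close>.\<close>

definition is_joint_pre_dual ::
  "('o, 'm, 'z) moncat_scheme \<Rightarrow> 'i set \<Rightarrow> ('i \<Rightarrow> 'o) \<Rightarrow> 'o \<Rightarrow> ('i \<Rightarrow> 'm) \<Rightarrow> bool" where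
  "is_joint_pre_dual C J Y P \<epsilon> \<longleftrightarrow>
     P \<in> Obj C \<and> (\<forall>j \<in> J. \<epsilon> j \<in> hom C (Tensor C P (Y j)) (Unit C)) \<and>
     (\<forall>T \<in> Obj C. \<forall>g. (\<forall>j \<in> J. g j \<in> hom C (Tensor C T (Y j)) (Unit C)) \<longrightarrow>
       (\<exists>!h. h \<in> hom C T P \<and>
         (\<forall>j \<in> J. Comp C (\<epsilon> j) (Tensor_arr C h (Ident C (Y j))) = g j)))"

context monoidal_category
begin

lemma uncurry_in_hom:
  assumes "X \<in> Obj C" and "e \<in> hom C (D \<otimes> X) I" and "u \<in> hom C T D"
  shows "e \<cdot> (u \<boxtimes> Ident C X) \<in> hom C (T \<otimes> X) I"
  using assms by (blast intro: Comp_in_hom Tensor_in_hom Ident_in_hom)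

text \<open>Unique solvability has the shape of the universal properties of products and joint
  pre-duals. This form serves both in \<open>C\<close> and, by interpretation, in Fam.\<close>

lemma is_pre_dual_iff:
  "is_pre_dual C X D e \<longleftrightarrow> X \<in> Obj C \<and> D \<in> Obj C \<and> e \<in> hom C (D \<otimes> X) (Unit C) \<and>
    (\<forall>T \<in> Obj C. \<forall>g \<in> hom C (T \<otimes> X) (Unit C).
      \<exists>!u. u \<in> hom C T D \<and> e \<cdot> (u \<boxtimes> Ident C X) = g)"
  unfolding is_pre_dual_def
\<comment> \<open>The congruence rules pass the typing of \<open>X\<close> and \<open>e\<close> on
  to the last conjunct, where it shows that the map lands in the hom set to the unit, as
  \<open>bij_betw_iff_ex1\<close> requires.\<close>
proof (intro conj_cong ball_cong refl bij_betw_iff_ex1 funcsetI)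
  fix T u
  assume "X \<in> Obj C" and "e \<in> hom C (D \<otimes> X) (Unit C)" and "u \<in> hom C T D"
  then show "e \<cdot> (u \<boxtimes> Ident C X) \<in> hom C (T \<otimes> X) (Unit C)"
    by (rule uncurry_in_hom)
qed

text \<open>Call \<open>e \<cdot> (u \<boxtimes> Ident C X)\<close> the transpose of
  \<open>u\<close>. By functoriality of the tensor product the left side is the transpose of
  \<open>p \<cdot> h\<close>, and transposition is injective.\<close>

lemma pre_dual_transpose_iff:
  assumes dual: "is_pre_dual C X D e"
    and p: "p \<in> hom C P D" and h: "h \<in> hom C T P" and g: "g \<in> hom C T D"
  shows "(e \<cdot> (p \<boxtimes> Ident C X)) \<cdot> (h \<boxtimes> Ident C X) = e \<cdot> (g \<boxtimes> Ident C X) \<longleftrightarrow> p \<cdot> h = g"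
proof -
  from dual have X: "X \<in> Obj C" and e: "e \<in> hom C (D \<otimes> X) (Unit C)"
    by (auto simp: is_pre_dual_def)
  note id = Ident_in_hom[OF X]
  have "(e \<cdot> (p \<boxtimes> Ident C X)) \<cdot> (h \<boxtimes> Ident C X) = e \<cdot> ((p \<boxtimes> Ident C X) \<cdot> (h \<boxtimes> Ident C X))"
    using Comp_assoc Tensor_in_hom[OF h id] Tensor_in_hom[OF p id] e by blast
  also have "\<dots> = e \<cdot> ((p \<cdot> h) \<boxtimes> Ident C X)"
    using Tensor_Comp[OF h p id id] Comp_Ident_left[OF id] by simp
  finally have eq: "(e \<cdot> (p \<boxtimes> Ident C X)) \<cdot> (h \<boxtimes> Ident C X) = e \<cdot> ((p \<cdot> h) \<boxtimes> Ident C X)" .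
  have "T \<in> Obj C"
    using g Dom_in_Obj by (auto simp: hom_def)
  then have "inj_on (\<lambda>u. e \<cdot> (u \<boxtimes> Ident C X)) (hom C T D)"
    using dual by (auto simp: is_pre_dual_def bij_betw_def)
  with Comp_in_hom[OF h p] g show ?thesis
    unfolding eq by (auto dest: inj_onD)
qed

text \<open>The evaluations are the transposes of the projections. If \<open>u j\<close> has
  transpose \<open>g j\<close>, then by \<open>pre_dual_transpose_iff\<close> the morphisms
  \<open>h\<close> that solve the problem for \<open>g\<close> are exactly those with
  \<open>\<pi> j \<cdot> h = u j\<close>.\<close>

lemma joint_pre_dual_of_product:
  assumes dual: "\<And>j. j \<in> J \<Longrightarrow> is_pre_dual C (Y j) (D j) (e j)"
    and prod: "is_product C J D P \<pi>"
  shows "is_joint_pre_dual C J Y P (\<lambda>j. e j \<cdot> (\<pi> j \<boxtimes> Ident C (Y j)))"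
  unfolding is_joint_pre_dual_def
proof (intro conjI ballI allI impI)
  from prod show "P \<in> Obj C"
    by (simp add: is_product_def)
  from prod have \<pi>: "\<pi> j \<in> hom C P (D j)" if "j \<in> J" for j
    using that by (simp add: is_product_def)
  show "e j \<cdot> (\<pi> j \<boxtimes> Ident C (Y j)) \<in> hom C (P \<otimes> Y j) (Unit C)" if "j \<in> J" for j
    using dual[OF that] \<pi>[OF that] by (auto simp: is_pre_dual_def intro: uncurry_in_hom)
  fix T g
  assume T: "T \<in> Obj C" and g: "\<forall>j \<in> J. g j \<in> hom C (T \<otimes> Y j) (Unit C)"
  have "\<forall>j \<in> J. \<exists>u. u \<in> hom C T (D j) \<and> e j \<cdot> (u \<boxtimes> Ident C (Y j)) = g j"
    using dual T g unfolding is_pre_dual_iff by blast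
  then obtain u where u: "\<And>j. j \<in> J \<Longrightarrow> u j \<in> hom C T (D j)"
    and eu: "\<And>j. j \<in> J \<Longrightarrow> e j \<cdot> (u j \<boxtimes> Ident C (Y j)) = g j"
    by metis
  have "(\<forall>j \<in> J. (e j \<cdot> (\<pi> j \<boxtimes> Ident C (Y j))) \<cdot> (h \<boxtimes> Ident C (Y j)) = g j) \<longleftrightarrow>
      (\<forall>j \<in> J. \<pi> j \<cdot> h = u j)" if "h \<in> hom C T P" for h
    using pre_dual_transpose_iff[OF dual \<pi> that u] eu by simp
  moreover have "\<exists>!h. h \<in> hom C T P \<and> (\<forall>j \<in> J. \<pi> j \<cdot> h = u j)"
    using prod T u by (simp add: is_product_def)
  ultimately show "\<exists>!h. h \<in> hom C T P \<and>
      (\<forall>j \<in> J. (e j \<cdot> (\<pi> j \<boxtimes> Ident C (Y j))) \<cdot> (h \<boxtimes> Ident C (Y j)) = g j)"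
    by (metis (no_types, lifting))
qed

text \<open>The same correspondence backwards: \<open>\<pi> j\<close> is the morphism with transpose
  \<open>\<epsilon> j\<close>, and a cone \<open>u\<close> is factored by applying the joint
  property to the transposes of its legs.\<close>

lemma product_of_joint_pre_dual:
  assumes dual: "\<And>j. j \<in> J \<Longrightarrow> is_pre_dual C (Y j) (D j) (e j)"
    and joint: "is_joint_pre_dual C J Y P \<epsilon>"
  shows "\<exists>\<pi>. is_product C J D P \<pi>"
proof -
  from joint have P: "P \<in> Obj C" and \<epsilon>: "\<forall>j \<in> J. \<epsilon> j \<in> hom C (P \<otimes> Y j) (Unit C)"
    by (auto simp: is_joint_pre_dual_def)
  have "\<forall>j \<in> J. \<exists>p. p \<in> hom C P (D j) \<and> e j \<cdot> (p \<boxtimes> Ident C (Y j)) = \<epsilon> j"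
    using dual P \<epsilon> unfolding is_pre_dual_iff by blast
  then obtain \<pi> where \<pi>: "\<And>j. j \<in> J \<Longrightarrow> \<pi> j \<in> hom C P (D j)"
    and e\<pi>: "\<And>j. j \<in> J \<Longrightarrow> e j \<cdot> (\<pi> j \<boxtimes> Ident C (Y j)) = \<epsilon> j"
    by metis
  have "is_product C J D P \<pi>"
    unfolding is_product_def
  proof (intro conjI ballI allI impI)
    show "D j \<in> Obj C" if "j \<in> J" for j
      using dual[OF that] by (simp add: is_pre_dual_def)
    fix T u
    assume T: "T \<in> Obj C" and "\<forall>j \<in> J. u j \<in> hom C T (D j)"
    then have u: "u j \<in> hom C T (D j)" if "j \<in> J" for j
      using that by blast
    have "(\<forall>j \<in> J. \<epsilon> j \<cdot> (h \<boxtimes> Ident C (Y j)) = e j \<cdot> (u j \<boxtimes> Ident C (Y j))) \<longleftrightarrow>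
        (\<forall>j \<in> J. \<pi> j \<cdot> h = u j)" if "h \<in> hom C T P" for h
      using pre_dual_transpose_iff[OF dual \<pi> that u] e\<pi> by simp
    moreover have "\<forall>j \<in> J. e j \<cdot> (u j \<boxtimes> Ident C (Y j)) \<in> hom C (T \<otimes> Y j) (Unit C)"
      using dual u by (auto simp: is_pre_dual_def intro!: uncurry_in_hom)
    with joint T have "\<exists>!h. h \<in> hom C T P \<and>
        (\<forall>j \<in> J. \<epsilon> j \<cdot> (h \<boxtimes> Ident C (Y j)) = e j \<cdot> (u j \<boxtimes> Ident C (Y j)))"
      unfolding is_joint_pre_dual_def
      by (elim conjE ballE[where x = T] allE[where x = "\<lambda>j. e j \<cdot> (u j \<boxtimes> Ident C (Y j))"]) auto
    ultimately show "\<exists>!h. h \<in> hom C T P \<and> (\<forall>j \<in> J. \<pi> j \<cdot> h = u j)"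
      by (metis (no_types, lifting))
  qed (use P \<pi> in auto)
  then show ?thesis by blast
qed

end

section \<open>Pre-duals in Fam and joint pre-duals in the base category\<close>

definition singleton_family :: "'i universe \<Rightarrow> 'o \<Rightarrow> ('i, 'o) family" where
  "singleton_family U A = Family {Point U} (\<lambda>k \<in> {Point U}. A)"

lemma singleton_family_simps [simp]:
  "index (singleton_family U A) = {Point U}"
  "member (singleton_family U A) (Point U) = A"
  by (simp_all add: singleton_family_def)

context monoidal_category_with_universe
begin

lemma singleton_family_in_families: "A \<in> Obj C \<Longrightarrow> singleton_family U A \<in> families U C"
  using universe by (auto simp: in_families_iff index_universe_def singleton_family_def)

text \<open>The unit family has a single index, so index maps into it agree automatically. What
  remains is one equation of components for each pair \<open>(i, j)\<close>.\<close>

lemma Fam_uncurry_eq_iff: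
  assumes E: "E \<in> hom (Fam U C) (family_tensor U C D X) (family_unit U C)"
    and X: "X \<in> families U C"
    and F: "F \<in> hom (Fam U C) T D"
    and G: "G \<in> hom (Fam U C) (family_tensor U C T X) (family_unit U C)"
  shows "Comp (Fam U C) E (Tensor_arr (Fam U C) F (Ident (Fam U C) X)) = G \<longleftrightarrow>
    (\<forall>i \<in> index T. \<forall>j \<in> index X.
      component E (pairing U (index_map F i, j)) \<cdot> (component F i \<boxtimes> Ident C (member X j)) =
      component G (pairing U (i, j)))"
    (is "?EF = G \<longleftrightarrow> ?eqs")
proof
  note FD = hom_FamD[OF F]
  assume eq: "?EF = G"
  show ?eqs
    by (simp flip: eq add: FD)
next
  note FD = hom_FamD[OF F] and ED = hom_FamD[OF E] and GD = hom_FamD[OF G]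
  assume eqs: ?eqs
  show "?EF = G"
  proof (rule hom_Fam_eqI)
    show "?EF \<in> hom (Fam U C) (family_tensor U C T X) (family_unit U C)"
      by (rule Fam_in_hom E X F)+
    fix k assume "k \<in> index (family_tensor U C T X)"
    then obtain i j where k: "k = pairing U (i, j)" and i: "i \<in> index T" and j: "j \<in> index X"
      by (auto elim: index_prodE)
    with ED(5)[of "pairing U (index_map F i, j)"] GD(5)[of k] FD(5)[OF i]
    show "index_map ?EF k = index_map G k"
      by (simp add: FD)
    show "component ?EF k = component G k"
      using eqs k i j by (simp add: FD)
  qed (rule G)
qed

text \<open>A morphism from \<open>T\<close> to a singleton family is a choice, for each index
  \<open>i\<close>, of a morphism from \<open>member T i\<close> to \<open>P\<close>. The conditions
  for different \<open>i\<close> are independent, and those at \<open>i\<close> are the universal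
  problem of \<open>P\<close> for row \<open>i\<close> of \<open>G\<close>.\<close>

lemma Fam_pre_dual_of_joint_pre_dual:
  assumes X: "X \<in> families U C"
    and joint: "is_joint_pre_dual C (index X) (member X) P \<epsilon>"
  shows "\<exists>E. is_pre_dual (Fam U C) X (singleton_family U P) E"
proof -
  interpret Fam: monoidal_category "Fam U C" by (rule monoidal_category_Fam)
  from joint have P: "P \<in> Obj C"
    and \<epsilon>: "\<And>j. j \<in> index X \<Longrightarrow> \<epsilon> j \<in> hom C (P \<otimes> member X j) (Unit C)"
    by (auto simp: is_joint_pre_dual_def)
  let ?D = "singleton_family U P"
  \<comment> \<open>The index map is forced; the component at \<open>pairing U (Point U, j)\<close>
    is \<open>\<epsilon> j\<close>.\<close>
  define E where "E = Family_arr (family_tensor U C ?D X) (family_unit U C)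
    (\<lambda>k \<in> index_prod U {Point U} (index X). Point U)
    (\<lambda>k \<in> index_prod U {Point U} (index X). \<epsilon> (proj2 U k))"
  have E: "E \<in> hom (Fam U C) (family_tensor U C ?D X) (family_unit U C)"
    by (rule hom_FamI) (auto simp: E_def P X \<epsilon> elim!: index_prodE
        intro!: family_tensor_in_families family_unit_in_families singleton_family_in_families)
  have "is_pre_dual (Fam U C) X ?D E"
    unfolding Fam.is_pre_dual_iff
  proof (unfold Fam_simps, intro conjI ballI)
    fix T G
    assume T: "T \<in> families U C"
      and G: "G \<in> hom (Fam U C) (family_tensor U C T X) (family_unit U C)"
    have g: "component G (pairing U (i, j)) \<in> hom C (member T i \<otimes> member X j) (Unit C)"
      if "i \<in> index T" and "j \<in> index X" for i j
      using that hom_FamD(5,6)[OF G, of "pairing U (i, j)"] by simp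
    have ex1: "\<exists>!h. h \<in> hom C (member T i) P \<and>
        (\<forall>j \<in> index X. \<epsilon> j \<cdot> (h \<boxtimes> Ident C (member X j)) = component G (pairing U (i, j)))"
      if "i \<in> index T" for i
    proof -
      \<comment> \<open>Quantifying over \<open>g\<close> first allows row \<open>i\<close> of
        \<open>G\<close> to be inserted afterwards as the test family.\<close>
      have "\<forall>g. (\<forall>j \<in> index X. g j \<in> hom C (member T i \<otimes> member X j) (Unit C)) \<longrightarrow>
          (\<exists>!h. h \<in> hom C (member T i) P \<and>
            (\<forall>j \<in> index X. \<epsilon> j \<cdot> (h \<boxtimes> Ident C (member X j)) = g j))"
        using joint member_in_Obj[OF T that] by (simp add: is_joint_pre_dual_def)
      from this[rule_format, of "\<lambda>j. component G (pairing U (i, j))"] show ?thesis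
        using g[OF that] by simp
    qed
    have eq_iff: "Comp (Fam U C) E (Tensor_arr (Fam U C) F (Ident (Fam U C) X)) = G \<longleftrightarrow>
        (\<forall>i \<in> index T. \<forall>j \<in> index X.
          \<epsilon> j \<cdot> (component F i \<boxtimes> Ident C (member X j)) = component G (pairing U (i, j)))"
      if F: "F \<in> hom (Fam U C) T ?D" for F
      unfolding Fam_uncurry_eq_iff[OF E X F G]
      using hom_FamD(5)[OF F] by (simp add: E_def)
    from ex1 obtain h where h: "\<And>i. i \<in> index T \<Longrightarrow> h i \<in> hom C (member T i) P"
      and h_eq: "\<And>i j. i \<in> index T \<Longrightarrow> j \<in> index X \<Longrightarrow>
        \<epsilon> j \<cdot> (h i \<boxtimes> Ident C (member X j)) = component G (pairing U (i, j))"
      by metis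
    define F where "F = Family_arr T ?D (\<lambda>i \<in> index T. Point U) (\<lambda>i \<in> index T. h i)"
    have F: "F \<in> hom (Fam U C) T ?D"
      by (rule hom_FamI) (auto simp: F_def T P h intro!: singleton_family_in_families)
    show "\<exists>!F. F \<in> hom (Fam U C) T ?D \<and>
        Comp (Fam U C) E (Tensor_arr (Fam U C) F (Ident (Fam U C) X)) = G"
    proof (rule ex1I, intro conjI)
      show "F \<in> hom (Fam U C) T ?D" by (rule F)
      show "Comp (Fam U C) E (Tensor_arr (Fam U C) F (Ident (Fam U C) X)) = G"
        unfolding eq_iff[OF F] by (simp add: F_def h_eq)
      fix F' assume "F' \<in> hom (Fam U C) T ?D \<and>
        Comp (Fam U C) E (Tensor_arr (Fam U C) F' (Ident (Fam U C) X)) = G"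
      then have F': "F' \<in> hom (Fam U C) T ?D"
        and F'_eq: "\<forall>i \<in> index T. \<forall>j \<in> index X.
          \<epsilon> j \<cdot> (component F' i \<boxtimes> Ident C (member X j)) = component G (pairing U (i, j))"
        using eq_iff by auto
      show "F' = F"
      proof (rule hom_Fam_eqI[OF F' F])
        fix i assume i: "i \<in> index T"
        show idx: "index_map F' i = index_map F i"
          using hom_FamD(5)[OF F' i] hom_FamD(5)[OF F i] by simp
        have "component F' i \<in> hom C (member T i) P"
          using hom_FamD(5,6)[OF F' i] by simp
        then have "component F' i = h i"
          using ex1[OF i] F'_eq h[OF i] h_eq[OF i] i by blast
        then show "component F' i = component F i"
          using i by (simp add: F_def)
      qed
    qed
  qed (use X P E singleton_family_in_families in auto)
  then show ?thesis ..
qed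

text \<open>At the singleton family on \<open>A\<close> the universal property of \<open>K\<close>
  yields an index \<open>k\<close> together with a morphism from \<open>A\<close> to
  \<open>member K k\<close>, and a priori \<open>k\<close> may vary with \<open>A\<close> and the
  test family. The initial object excludes this: over \<open>Z\<close> every index solves the same
  problem, so uniqueness leaves a single index.\<close>

lemma joint_pre_dual_of_Fam_pre_dual:
  assumes Z: "is_initial C Z"
    and dual: "\<And>j. j \<in> index X \<Longrightarrow> is_pre_dual C (member X j) (D j) (e j)"
    and Fam_dual: "is_pre_dual (Fam U C) X K E"
  shows "\<exists>P \<epsilon>. is_joint_pre_dual C (index X) (member X) P \<epsilon>"
proof -
  interpret Fam: monoidal_category "Fam U C" by (rule monoidal_category_Fam)
  from Fam_dual have X: "X \<in> families U C" and K: "K \<in> families U C"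
    and E: "E \<in> hom (Fam U C) (family_tensor U C K X) (family_unit U C)"
    by (simp_all add: is_pre_dual_def)
  \<comment> \<open>\<open>sol A g k u\<close> expresses that the morphism in Fam from the singleton
    family on \<open>A\<close> with index value \<open>k\<close> and component \<open>u\<close> has
    transpose \<open>g\<close>. Keeping \<open>k\<close> and \<open>u\<close> apart lets the index
    be studied on its own.\<close>
  define sol where "sol A g k u \<longleftrightarrow> k \<in> index K \<and> u \<in> hom C A (member K k) \<and>
      (\<forall>j \<in> index X. component E (pairing U (k, j)) \<cdot> (u \<boxtimes> Ident C (member X j)) = g j)"
    for A g k u
  have sol_ex: "\<exists>k u. sol A g k u"
    and sol_unique: "sol A g k u \<Longrightarrow> sol A g k' u' \<Longrightarrow> k = k' \<and> u = u'"
    if A: "A \<in> Obj C" and g: "\<And>j. j \<in> index X \<Longrightarrow> g j \<in> hom C (A \<otimes> member X j) (Unit C)"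
    for A g k u k' u'
  proof -
    \<comment> \<open>The morphism \<open>G\<close> packs \<open>g\<close> into a morphism of Fam to
      the unit.\<close>
    let ?A = "singleton_family U A"
    define G where "G = Family_arr (family_tensor U C ?A X) (family_unit U C)
      (\<lambda>k \<in> index_prod U {Point U} (index X). Point U)
      (\<lambda>k \<in> index_prod U {Point U} (index X). g (proj2 U k))"
    have G: "G \<in> hom (Fam U C) (family_tensor U C ?A X) (family_unit U C)"
      by (rule hom_FamI) (auto simp: G_def A X g elim!: index_prodE
          intro!: family_tensor_in_families family_unit_in_families singleton_family_in_families)
    have ex1: "\<exists>!F. F \<in> hom (Fam U C) ?A K \<and>
        Comp (Fam U C) E (Tensor_arr (Fam U C) F (Ident (Fam U C) X)) = G"
      using Fam_dual G singleton_family_in_families[OF A] by (simp add: Fam.is_pre_dual_iff)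
    have sol_iff: "sol A g (index_map F (Point U)) (component F (Point U)) \<longleftrightarrow>
        Comp (Fam U C) E (Tensor_arr (Fam U C) F (Ident (Fam U C) X)) = G"
      if F: "F \<in> hom (Fam U C) ?A K" for F
      unfolding Fam_uncurry_eq_iff[OF E X F G] sol_def
      using hom_FamD(5,6)[OF F, of "Point U"] by (simp add: G_def)
    show "\<exists>k u. sol A g k u"
      using ex1 sol_iff by blast
    \<comment> \<open>Conversely, a pair of \<open>k\<close> and \<open>u\<close> is packed into a
      morphism of Fam, so that uniqueness there applies to pairs.\<close>
    define arr where "arr k u = Family_arr ?A K (\<lambda>_ \<in> {Point U}. k) (\<lambda>_ \<in> {Point U}. u)"
      for k and u :: 'm
    have arr: "arr k u \<in> hom (Fam U C) ?A K \<and>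
        Comp (Fam U C) E (Tensor_arr (Fam U C) (arr k u) (Ident (Fam U C) X)) = G"
      if "sol A g k u" for k u
    proof -
      have "arr k u \<in> hom (Fam U C) ?A K"
        using that
        by (intro hom_FamI) (auto simp: arr_def sol_def A K intro!: singleton_family_in_families)
      then show ?thesis
        using that sol_iff[of "arr k u"] by (simp add: arr_def)
    qed
    assume "sol A g k u" and "sol A g k' u'"
    then have "arr k u = arr k' u'"
      using arr ex1 by blast
    \<comment> \<open>Evaluation at \<open>Point U\<close> recovers \<open>k\<close> and
      \<open>u\<close> from the restricted functions.\<close>
    then show "k = k' \<and> u = u'"
      by (simp add: arr_def) (metis restrict_apply' singletonI)
  qed

  from Z have ZO: "Z \<in> Obj C"
    and Z1: "\<And>A. A \<in> Obj C \<Longrightarrow> \<exists>!f. f \<in> hom C Z A"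
    by (auto simp: is_initial_def)
  \<comment> \<open>Transposition maps \<open>hom C Z (D j)\<close>, a singleton by initiality of
    \<open>Z\<close>, bijectively onto this hom set.\<close>
  have Z_uncurry: "\<exists>!f. f \<in> hom C (Z \<otimes> member X j) (Unit C)" if "j \<in> index X" for j
  proof -
    have "bij_betw (\<lambda>u. e j \<cdot> (u \<boxtimes> Ident C (member X j)))
        (hom C Z (D j)) (hom C (Z \<otimes> member X j) (Unit C))"
      and "D j \<in> Obj C"
      using dual[OF that] ZO by (simp_all add: is_pre_dual_def)
    moreover obtain z where "hom C Z (D j) = {z}"
      using Z1[OF \<open>D j \<in> Obj C\<close>] by blast
    ultimately have "hom C (Z \<otimes> member X j) (Unit C) = {e j \<cdot> (z \<boxtimes> Ident C (member X j))}"
      by (simp add: bij_betw_def)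
    then show ?thesis
      by simp
  qed
  then obtain g where g: "\<And>j. j \<in> index X \<Longrightarrow> g j \<in> hom C (Z \<otimes> member X j) (Unit C)"
    by metis
  have E_in_hom: "component E (pairing U (k, j)) \<in> hom C (member K k \<otimes> member X j) (Unit C)"
    if "k \<in> index K" and "j \<in> index X" for k j
    using that hom_FamD(5,6)[OF E, of "pairing U (k, j)"] by simp
  \<comment> \<open>The morphism from \<open>Z\<close> always works: both sides of each equation lie
    in a one-element hom set.\<close>
  have Z_sol: "\<exists>u. sol Z g k u" if k: "k \<in> index K" for k
  proof -
    obtain u where u: "u \<in> hom C Z (member K k)"
      using Z1 member_in_Obj[OF K k] by blast
    have "component E (pairing U (k, j)) \<cdot> (u \<boxtimes> Ident C (member X j)) = g j"
      if j: "j \<in> index X" for j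
      using Z_uncurry[OF j] g[OF j] uncurry_in_hom[OF member_in_Obj[OF X j] E_in_hom[OF k j] u]
      by blast
    with k u show ?thesis
      unfolding sol_def by blast
  qed
  \<comment> \<open>Existence of a solution over \<open>Z\<close> shows that \<open>index K\<close>
    is nonempty, also when \<open>index X\<close> is empty.\<close>
  obtain k where k: "k \<in> index K"
    using sol_ex[OF ZO g] by (auto simp: sol_def)
  have K_eq: "k' = k" if k': "k' \<in> index K" for k'
  proof -
    obtain u u' where "sol Z g k u" and "sol Z g k' u'"
      using Z_sol[OF k] Z_sol[OF k'] by blast
    from sol_unique[OF ZO g this] show ?thesis by simp
  qed

  \<comment> \<open>As \<open>k\<close> is the only index, unique existence of the pair becomes
    unique existence of its second entry.\<close>
  have "is_joint_pre_dual C (index X) (member X) (member K k)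
      (\<lambda>j. component E (pairing U (k, j)))"
    unfolding is_joint_pre_dual_def
  proof (intro conjI ballI allI impI)
    fix A g
    assume A: "A \<in> Obj C" and "\<forall>j \<in> index X. g j \<in> hom C (A \<otimes> member X j) (Unit C)"
    then have g: "g j \<in> hom C (A \<otimes> member X j) (Unit C)" if "j \<in> index X" for j
      using that by blast
    obtain k' u where "sol A g k' u"
      using sol_ex[OF A g] by blast
    moreover from this have "k' = k"
      by (intro K_eq) (simp add: sol_def)
    ultimately have "sol A g k u" by simp
    with sol_unique[OF A g] have "\<exists>!u. sol A g k u" by blast
    then show "\<exists>!u. u \<in> hom C A (member K k) \<and>
        (\<forall>j \<in> index X. component E (pairing U (k, j)) \<cdot> (u \<boxtimes> Ident C (member X j)) = g j)"
      unfolding sol_def using k by simp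
  qed (use k K E_in_hom member_in_Obj in auto)
  then show ?thesis by blast
qed

end

section \<open>Pre-rigidity of Fam and products of pre-duals\<close>

theorem proposition3p1:
  fixes U :: "'i universe"
    and C :: "('o, 'm) moncat"
    and dual :: "'o \<Rightarrow> 'o"
    and ev :: "'o \<Rightarrow> 'm"
  assumes "index_universe U"
    and "pre_rigid C"
    and "\<And>X. X \<in> Obj C \<Longrightarrow> is_pre_dual C X (dual X) (ev X)"
  shows "(has_products_of_pre_duals U C dual \<longrightarrow>
      pre_rigid (Fam U C) \<and>
      (\<forall>J Y P \<pi>. Family J Y \<in> Obj (Fam U C) \<and> is_product C J (\<lambda>j. dual (Y j)) P \<pi> \<longrightarrow>
        (\<exists>e. is_pre_dual (Fam U C) (Family J Y) (Family {Point U} (\<lambda>k \<in> {Point U}. P)) e))) \<and>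
    ((\<exists>Z. is_initial C Z) \<and> pre_rigid (Fam U C) \<longrightarrow> has_products_of_pre_duals U C dual)"
proof -
  interpret monoidal_category C
    using assms(2) by (simp add: pre_rigid_def)
  interpret monoidal_category_with_universe C U
    by unfold_locales (rule assms(1))
  \<comment> \<open>An arbitrary product cone is allowed, so that this gives both pre-rigidity and
    the explicit form of the pre-dual.\<close>
  have Fam_dual: "\<exists>e. is_pre_dual (Fam U C) X (singleton_family U P) e"
    if X: "X \<in> families U C" and "is_product C (index X) (\<lambda>j. dual (member X j)) P \<pi>" for X P \<pi>
    using joint_pre_dual_of_product[OF assms(3)[OF member_in_Obj[OF X]] that(2)]
    by (rule Fam_pre_dual_of_joint_pre_dual[OF X])
  have "pre_rigid (Fam U C)" if "has_products_of_pre_duals U C dual"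
    unfolding pre_rigid_def
  proof (intro conjI ballI monoidal_category_Fam)
    fix X assume "X \<in> Obj (Fam U C)"
    then have X: "X \<in> families U C" by simp
    then have "index X \<in> Small U" by (simp add: in_families_iff)
    with that member_in_Obj[OF X]
    obtain P \<pi> where "is_product C (index X) (\<lambda>j. dual (member X j)) P \<pi>"
      unfolding has_products_of_pre_duals_def by blast
    with Fam_dual[OF X] show "\<exists>D e. is_pre_dual (Fam U C) X D e" by blast
  qed
  moreover have "\<exists>e. is_pre_dual (Fam U C) (Family J Y) (Family {Point U} (\<lambda>k \<in> {Point U}. P)) e"
    if "Family J Y \<in> Obj (Fam U C)" and "is_product C J (\<lambda>j. dual (Y j)) P \<pi>" for J Y P \<pi>
    using Fam_dual[of "Family J Y" P \<pi>] that by (simp add: singleton_family_def)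
  moreover have "has_products_of_pre_duals U C dual"
    if Z: "is_initial C Z" and Fam: "pre_rigid (Fam U C)" for Z
    unfolding has_products_of_pre_duals_def
  proof (intro ballI allI impI)
    fix J Y assume J: "J \<in> Small U" and Y: "\<forall>j \<in> J. Y j \<in> Obj C"
    \<comment> \<open>Restriction makes the family extensional, hence an object of Fam; on
      \<open>J\<close> its members are still the \<open>Y j\<close>, with the chosen pre-duals
      \<open>dual (Y j)\<close>.\<close>
    let ?X = "Family J (restrict Y J)"
    have "?X \<in> Obj (Fam U C)"
      using J Y by (simp add: in_families_iff)
    with Fam obtain K E where KE: "is_pre_dual (Fam U C) ?X K E"
      unfolding pre_rigid_def by blast
    have dual: "is_pre_dual C (member ?X j) (dual (Y j)) (ev (Y j))" if "j \<in> index ?X" for j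
      using that Y assms(3) by simp
    from joint_pre_dual_of_Fam_pre_dual[OF Z dual KE]
    obtain P \<epsilon> where "is_joint_pre_dual C (index ?X) (member ?X) P \<epsilon>" by blast
    from product_of_joint_pre_dual[OF dual this]
    show "\<exists>P \<pi>. is_product C J (\<lambda>j. dual (Y j)) P \<pi>" by auto
  qed
  ultimately show ?thesis by blast
qed

end
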